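(* If $f(q)\in\hat\Lambda^b$, then $f(e^{1/x})\in\mathbb Q[[1/x]]$ is Gevrey.
   Context: A series $\sum_{n\ge0}a_nx^{-n}\in\mathbb C[[1/x]]$ is Gevrey if there is $C>0$ with $|a_n|\le C^n\,n!$ for all $n>0$. $(q)_n=(1-q)\cdots(1-q^n)$ and $\hat\Lambda=\varprojlim_n\mathbb Z[q^{\pm1}]/((q)_n)$ is the Habiro ring; every element can be written (non-uniquely) as $f(q)=\sum_{n\ge0}f_n(q)(q)_n$ with $f_n(q)\in\mathbb Z[q^{\pm1}]$. Since $(e^{1/x})_n\in x^{-n}\mathbb Q[[1/x]]$ (where $(e^{1/x})_n$ denotes $(q)_n$ at $q=e^{1/x}$), the series $f(e^{1/x})=\sum_{n\ge0}f_n(e^{1/x})(e^{1/x})_n$ is a well-defined element of $\mathbb Q[[1/x]]$. A sequence $(f_n(q))$ of Laurent polynomials is nicely bounded if there are constants $C,C'>0$ such that for all $n>0$ all exponents of $q$ occurring in $f_n(q)$ lie in $[-C'n^2,C'n^2]$ and $\|f_n(q)\|_1\le C^n$, where $\|\cdot\|_1$ is the sum of absolute values of the coefficients. $\hat\Lambda^b$ is the set of $f\in\hat\Lambda$ that can be written as $\sum_{n\ge0}f_n(q)(q)_n$ with $f_n(q)\in\mathbb Z[q^{\pm1}]$ and $(f_n(q))$ nicely bounded. *)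

theory Defs
  imports
    Complex_Main
    "HOL-Library.Poly_Mapping"
    "HOL-Computational_Algebra.Formal_Power_Series"
    "HOL-Algebra.QuotRing"
begin

definition q_pochhammer :: "'a::comm_ring_1 \<Rightarrow> nat \<Rightarrow> 'a" where
  "q_pochhammer q n = (\<Prod>i=1..n. 1 - q ^ i)"

text \<open>
  A Laurent polynomial maps each exponent to its coefficient; multiplication is the
  convolution product of \<^theory>\<open>HOL-Library.Poly_Mapping\<close>.
\<close>

type_synonym laurent = "int \<Rightarrow>\<^sub>0 int"

definition laurent_q :: laurent where
  "laurent_q = Poly_Mapping.single 1 1"

definition laurent_norm1 :: "laurent \<Rightarrow> int" where
  "laurent_norm1 p = (\<Sum>k\<in>Poly_Mapping.keys p. \<bar>Poly_Mapping.lookup p k\<bar>)"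

definition laurent_ring :: "laurent ring" where
  "laurent_ring = \<lparr>carrier = UNIV, mult = (*), one = 1, zero = 0, add = (+)\<rparr>"

definition q_ideal :: "nat \<Rightarrow> laurent set" where
  "q_ideal n = PIdl\<^bsub>laurent_ring\<^esub> (q_pochhammer laurent_q n)"

abbreviation q_quotient :: "nat \<Rightarrow> laurent set ring" where
  "q_quotient n \<equiv> laurent_ring Quot q_ideal n"

abbreviation q_class :: "nat \<Rightarrow> laurent \<Rightarrow> laurent set" where
  "q_class n p \<equiv> q_ideal n +>\<^bsub>laurent_ring\<^esub> p"

text \<open>
  The inverse limit, realised as the ring of families of residue classes, one for each \<open>n\<close>,
  that correspond under the projections from the \<open>n\<close>-th to the \<open>m\<close>-th quotient, \<open>m \<le> n\<close>.
\<close>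

definition habiro_ring :: "(nat \<Rightarrow> laurent set) ring" where
  "habiro_ring =
    \<lparr>carrier = {f. (\<forall>n. f n \<in> carrier (q_quotient n)) \<and>
       (\<forall>m n p. m \<le> n \<longrightarrow> f n = q_class n p \<longrightarrow> f m = q_class m p)},
     mult = (\<lambda>f g n. f n \<otimes>\<^bsub>q_quotient n\<^esub> g n),
     one = (\<lambda>n. \<one>\<^bsub>q_quotient n\<^esub>),
     zero = (\<lambda>n. \<zero>\<^bsub>q_quotient n\<^esub>),
     add = (\<lambda>f g n. f n \<oplus>\<^bsub>q_quotient n\<^esub> g n)\<rparr>"

text \<open>
  The element \<open>\<Sum>n\<ge>0. c n * (q)\<^sub>n\<close> of the inverse limit: modulo \<open>(q)\<^sub>N\<close> only the terms with
  \<open>n < N\<close> survive.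
\<close>

definition habiro_series :: "(nat \<Rightarrow> laurent) \<Rightarrow> nat \<Rightarrow> laurent set" where
  "habiro_series c = (\<lambda>N. q_class N (\<Sum>n<N. c n * q_pochhammer laurent_q n))"

lemma cring_laurent_ring: "cring laurent_ring"
proof (rule cringI)
  show "abelian_group laurent_ring"
    by (rule abelian_groupI)
       (auto simp: laurent_ring_def algebra_simps intro: exI[of _ "- x" for x] ab_left_minus)
  show "comm_monoid laurent_ring"
    by unfold_locales (auto simp: laurent_ring_def algebra_simps)
qed (auto simp: laurent_ring_def algebra_simps)

lemma ideal_q_ideal: "ideal (q_ideal n) laurent_ring"
  unfolding q_ideal_def
  by (rule cring.cgenideal_ideal[OF cring_laurent_ring]) (simp add: laurent_ring_def)

lemma q_ideal_iff: "p \<in> q_ideal n \<longleftrightarrow> q_pochhammer laurent_q n dvd p"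
  by (auto simp: q_ideal_def cgenideal_def laurent_ring_def dvd_def mult.commute)

lemma q_class_conv: "q_class n p = {r. q_pochhammer laurent_q n dvd r - p}"
proof -
  have "q_class n p = (\<lambda>h. h + p) ` q_ideal n"
    by (auto simp: a_r_coset_def r_coset_def laurent_ring_def)
  also have "\<dots> = {r. r - p \<in> q_ideal n}"
    by (auto intro: image_eqI[of _ _ "r - p" for r])
  finally show ?thesis by (simp add: q_ideal_iff)
qed

lemma q_class_eq_iff: "q_class n p = q_class n p' \<longleftrightarrow> q_pochhammer laurent_q n dvd p - p'"
proof
  assume "q_class n p = q_class n p'"
  then have "p \<in> q_class n p'" by (metis (mono_tags) q_class_conv diff_self dvd_0_right mem_Collect_eq)
  then show "q_pochhammer laurent_q n dvd p - p'" by (simp add: q_class_conv)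
next
  assume *: "q_pochhammer laurent_q n dvd p - p'"
  have "q_pochhammer laurent_q n dvd r - p \<longleftrightarrow> q_pochhammer laurent_q n dvd r - p'" for r
    using dvd_add_right_iff[OF *, of "r - p"] by simp
  then show "q_class n p = q_class n p'" by (simp add: q_class_conv)
qed

lemma carrier_q_quotient: "carrier (q_quotient n) = range (q_class n)"
  by (auto simp: FactRing_def A_RCOSETS_def RCOSETS_def a_r_coset_def laurent_ring_def)

lemma q_pochhammer_dvd: "m \<le> n \<Longrightarrow> q_pochhammer q m dvd q_pochhammer q n"
  unfolding q_pochhammer_def by (rule prod_dvd_prod_subset) auto

lemma q_pochhammer_dvd_sum_diff:
  assumes "m \<le> n"
  shows "q_pochhammer q m dvd (\<Sum>i<n. c i * q_pochhammer q i) - (\<Sum>i<m. c i * q_pochhammer q i)"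
proof -
  have "{..<n} = {..<m} \<union> {m..<n}" using assms by auto
  then have "(\<Sum>i<n. c i * q_pochhammer q i) - (\<Sum>i<m. c i * q_pochhammer q i) =
      (\<Sum>i=m..<n. c i * q_pochhammer q i)"
    by (simp add: sum.union_disjoint ivl_disj_int)
  then show ?thesis by (auto intro!: dvd_sum dvd_mult q_pochhammer_dvd)
qed

lemma habiro_series_closed: "habiro_series c \<in> carrier habiro_ring"
proof -
  have "habiro_series c m = q_class m p" if "m \<le> n" "habiro_series c n = q_class n p" for m n p
  proof -
    let ?s = "\<lambda>n. \<Sum>i<n. c i * q_pochhammer laurent_q i"
    have "q_pochhammer laurent_q n dvd ?s n - p"
      using that(2) by (simp only: habiro_series_def q_class_eq_iff)
    with q_pochhammer_dvd[OF that(1)] have "q_pochhammer laurent_q m dvd ?s n - p"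
      by (rule dvd_trans)
    moreover have "q_pochhammer laurent_q m dvd ?s n - ?s m"
      using that(1) by (rule q_pochhammer_dvd_sum_diff)
    ultimately have "q_pochhammer laurent_q m dvd (?s n - p) - (?s n - ?s m)"
      by (rule dvd_diff)
    then show ?thesis by (simp add: habiro_series_def q_class_eq_iff)
  qed
  then show ?thesis
    by (auto simp: habiro_ring_def carrier_q_quotient) (simp add: habiro_series_def)
qed

lemma habiro_series_surj:
  assumes f: "f \<in> carrier habiro_ring"
  obtains c where "f = habiro_series c"
proof -
  have "\<forall>n. f n \<in> range (q_class n)"
    using f by (simp add: habiro_ring_def carrier_q_quotient)
  then have "\<forall>n. \<exists>p. f n = q_class n p" by blast
  then obtain p where p: "\<And>n. f n = q_class n (p n)" by metis
  have compat: "f m = q_class m r" if "m \<le> n" "f n = q_class n r" for m n r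
    using f that by (simp add: habiro_ring_def)
  have "f n = q_class n (p (Suc n))" for n
    by (rule compat[of n "Suc n"]) (simp_all add: p)
  then have "\<forall>n. q_pochhammer laurent_q n dvd p (Suc n) - p n"
    by (metis p q_class_eq_iff)
  then obtain d where d: "\<And>n. p (Suc n) - p n = q_pochhammer laurent_q n * d n"
    unfolding dvd_def by metis
  have "p N - p 0 = (\<Sum>n<N. d n * q_pochhammer laurent_q n)" for N
  proof (induction N)
    case (Suc N)
    have "p (Suc N) - p 0 = (p N - p 0) + (p (Suc N) - p N)" by simp
    then show ?case using Suc d[of N] by (simp add: mult.commute)
  qed simp
  then have ps: "p N = p 0 + (\<Sum>n<N. d n * q_pochhammer laurent_q n)" for N
    by (metis add.commute diff_add_cancel)
  define c where "c n = (if n = 0 then p 0 + d 0 else d n)" for n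
  have "f N = habiro_series c N" for N
  proof (cases N)
    case 0
    then show ?thesis
      by (simp add: p habiro_series_def q_class_eq_iff q_pochhammer_def)
  next
    case (Suc M)
    have "(\<Sum>n<N. c n * q_pochhammer laurent_q n) =
        (\<Sum>n<N. d n * q_pochhammer laurent_q n + (if n = 0 then p 0 else 0))"
      by (intro sum.cong) (auto simp: c_def q_pochhammer_def)
    also have "\<dots> = p 0 + (\<Sum>n<N. d n * q_pochhammer laurent_q n)"
      using Suc by (simp only: sum.distrib) (simp add: sum.delta add.commute)
    also have "\<dots> = p N" by (rule ps[symmetric])
    finally show ?thesis by (simp add: p habiro_series_def)
  qed
  then show ?thesis using that by blast
qed

definition nicely_bounded :: "(nat \<Rightarrow> laurent) \<Rightarrow> bool" where
  "nicely_bounded c \<longleftrightarrow> (\<exists>C C'. C > (0::real) \<and> C' > (0::real) \<and>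
     (\<forall>n>0. (\<forall>k\<in>Poly_Mapping.keys (c n). real_of_int k \<in> {- C' * real n ^ 2 .. C' * real n ^ 2}) \<and>
            real_of_int (laurent_norm1 (c n)) \<le> C ^ n))"

definition habiro_bounded :: "(nat \<Rightarrow> laurent set) set" where
  "habiro_bounded = {f \<in> carrier habiro_ring. \<exists>c. nicely_bounded c \<and> f = habiro_series c}"

text \<open>
  Power series in \<open>1/x\<close> are formal power series whose variable \<^const>\<open>fps_X\<close> stands for \<open>1/x\<close>,
  so that \<open>e\<^bsup>1/x\<^esup>\<close> is \<open>fps_exp 1\<close>.
\<close>

definition laurent_eval :: "'a::{comm_ring_1,inverse} \<Rightarrow> laurent \<Rightarrow> 'a" where
  "laurent_eval u p = (\<Sum>k\<in>Poly_Mapping.keys p. of_int (Poly_Mapping.lookup p k) * u powi k)"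

text \<open>Convergence is in the \<open>fps_X\<close>-adic metric.\<close>

definition habiro_at_exp :: "(nat \<Rightarrow> laurent set) \<Rightarrow> rat fps" where
  "habiro_at_exp f = (THE F. \<exists>c. f = habiro_series c \<and>
     (\<lambda>n. laurent_eval (fps_exp 1) (c n) * q_pochhammer (fps_exp 1) n) sums F)"

lemma laurent_eval_superset:
  assumes "finite A" "Poly_Mapping.keys p \<subseteq> A"
  shows "laurent_eval u p = (\<Sum>k\<in>A. of_int (Poly_Mapping.lookup p k) * u powi k)"
  unfolding laurent_eval_def using assms
  by (intro sum.mono_neutral_left) (auto simp: in_keys_iff)

lemma laurent_eval_diff: "laurent_eval u (p - p') = laurent_eval u p - laurent_eval u p'"
proof -
  let ?A = "Poly_Mapping.keys p \<union> Poly_Mapping.keys p'"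
  have "Poly_Mapping.keys (p - p') \<subseteq> ?A" by (rule keys_diff)
  then show ?thesis
    by (simp add: laurent_eval_superset[of ?A] lookup_minus left_diff_distrib sum_subtractf)
qed

lemma fps_exp_powi: "fps_exp (1 :: rat) powi k = fps_exp (of_int k)"
  by (simp add: power_int_def fps_exp_power_mult flip: fps_exp_neg)

lemma laurent_eval_single:
  "laurent_eval (fps_exp (1 :: rat)) (Poly_Mapping.single k a) = of_int a * fps_exp (of_int k)"
  by (subst laurent_eval_superset[of "{k}"]) (auto simp: fps_exp_powi)

lemma laurent_eval_0 [simp]: "laurent_eval u 0 = 0"
  by (simp add: laurent_eval_def)

lemma laurent_eval_mult:
  "laurent_eval (fps_exp (1 :: rat)) (p * p') =
     laurent_eval (fps_exp 1) p * laurent_eval (fps_exp 1) p'"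
proof (rule frag_induction[where S = UNIV and c = p])
  fix k :: int
  show "laurent_eval (fps_exp (1 :: rat)) (frag_of k * p') =
     laurent_eval (fps_exp 1) (frag_of k) * laurent_eval (fps_exp 1) p'"
  proof (rule frag_induction[where S = UNIV and c = p'])
    fix l :: int
    show "laurent_eval (fps_exp (1 :: rat)) (frag_of k * frag_of l) =
       laurent_eval (fps_exp 1) (frag_of k) * laurent_eval (fps_exp 1) (frag_of l)"
      by (simp add: mult_single laurent_eval_single fps_exp_add_mult)
  qed (auto simp: right_diff_distrib laurent_eval_diff)
qed (auto simp: left_diff_distrib laurent_eval_diff)

lemma laurent_eval_1: "laurent_eval (fps_exp (1 :: rat)) 1 = 1"
  by (subst single_one[symmetric], subst laurent_eval_single) simp

lemma laurent_eval_power: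
  "laurent_eval (fps_exp (1 :: rat)) (p ^ n) = laurent_eval (fps_exp 1) p ^ n"
  by (induction n) (simp_all add: laurent_eval_1 laurent_eval_mult)

lemma laurent_eval_q_pochhammer:
  "laurent_eval (fps_exp (1 :: rat)) (q_pochhammer laurent_q n) = q_pochhammer (fps_exp 1) n"
proof -
  have q: "laurent_eval (fps_exp (1 :: rat)) laurent_q = fps_exp 1"
    by (simp add: laurent_q_def laurent_eval_single)
  show ?thesis
    by (induction n)
       (simp_all add: q_pochhammer_def laurent_eval_1 laurent_eval_mult laurent_eval_diff
          laurent_eval_power q mult.commute del: power_Suc)
qed

lemma laurent_eval_sum:
  "laurent_eval u (\<Sum>i\<in>A. g i) = (\<Sum>i\<in>A. laurent_eval u (g i))"
proof (induction A rule: infinite_finite_induct)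
  case (insert x A)
  have "laurent_eval u (g x + sum g A) = laurent_eval u (g x) + laurent_eval u (sum g A)"
    using laurent_eval_diff[of u "g x + sum g A" "sum g A"] by (simp add: algebra_simps)
  then show ?case using insert by simp
qed auto

lemma fps_X_power_dvd_q_pochhammer: "fps_X ^ n dvd q_pochhammer (fps_exp (1 :: rat)) n"
proof -
  have "fps_X dvd 1 - fps_exp (1 :: rat) ^ i" for i
  proof
    show "1 - fps_exp (1 :: rat) ^ i = fps_X * fps_shift 1 (1 - fps_exp 1 ^ i)"
      by (rule fps_ext) (auto simp: fps_exp_power_mult)
  qed
  then have "(\<Prod>i=1..n. fps_X) dvd (\<Prod>i=1..n. 1 - fps_exp (1 :: rat) ^ i)"
    by (intro prod_dvd_prod)
  then show ?thesis by (simp add: q_pochhammer_def)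
qed

lemma fps_X_power_dvd_nth:
  assumes "fps_X ^ n dvd (F :: 'a::comm_ring_1 fps)" "m < n"
  shows "fps_nth F m = 0"
  using assms by (auto simp: dvd_def fps_X_power_mult_nth)

lemma habiro_series_sums:
  fixes c :: "nat \<Rightarrow> laurent"
  defines "t \<equiv> (\<lambda>n. laurent_eval (fps_exp (1 :: rat)) (c n) * q_pochhammer (fps_exp 1) n)"
  shows "t sums Abs_fps (\<lambda>m. fps_nth (\<Sum>n<Suc m. t n) m)"
  unfolding sums_def tendsto_fps_iff
proof
  fix m
  have "fps_nth (\<Sum>n<N. t n) m = fps_nth (\<Sum>n<Suc m. t n) m" if "N \<ge> Suc m" for N
  proof -
    have "fps_X ^ Suc m dvd (\<Sum>n<N. t n) - (\<Sum>n<Suc m. t n)"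
      unfolding t_def
      by (rule dvd_trans[OF fps_X_power_dvd_q_pochhammer q_pochhammer_dvd_sum_diff[OF that]])
    from fps_X_power_dvd_nth[OF this, of m] show ?thesis by simp
  qed
  then show "eventually (\<lambda>N. fps_nth (\<Sum>n<N. t n) m =
      fps_nth (Abs_fps (\<lambda>m. fps_nth (\<Sum>n<Suc m. t n) m)) m) sequentially"
    by (auto intro!: eventually_sequentiallyI[of "Suc m"])
qed

lemma habiro_series_sums_unique:
  assumes eq: "habiro_series c = habiro_series c'"
    and F: "(\<lambda>n. laurent_eval (fps_exp (1 :: rat)) (c n) * q_pochhammer (fps_exp 1) n) sums F"
    and F': "(\<lambda>n. laurent_eval (fps_exp (1 :: rat)) (c' n) * q_pochhammer (fps_exp 1) n) sums F'"
  shows "F = F'"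
proof -
  let ?t = "\<lambda>c N. \<Sum>n<N. laurent_eval (fps_exp (1 :: rat)) (c n) * q_pochhammer (fps_exp 1) n"
  let ?s = "\<lambda>c N. \<Sum>n<N. c n * q_pochhammer laurent_q n"
  have t: "?t c N = laurent_eval (fps_exp 1) (?s c N)" for c N
    by (simp add: laurent_eval_sum laurent_eval_mult laurent_eval_q_pochhammer)
  have dvd: "fps_X ^ N dvd ?t c N - ?t c' N" for N
  proof -
    have "q_pochhammer laurent_q N dvd ?s c N - ?s c' N"
      using eq by (metis (no_types) habiro_series_def q_class_eq_iff)
    then obtain r where r: "?s c N - ?s c' N = q_pochhammer laurent_q N * r" by (rule dvdE)
    have "?t c N - ?t c' N = laurent_eval (fps_exp 1) (?s c N - ?s c' N)"
      by (simp only: t laurent_eval_diff)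
    also have "\<dots> = q_pochhammer (fps_exp 1) N * laurent_eval (fps_exp 1) r"
      by (simp only: r laurent_eval_mult laurent_eval_q_pochhammer)
    finally have "?t c N - ?t c' N = q_pochhammer (fps_exp 1) N * laurent_eval (fps_exp 1) r" .
    then show ?thesis using fps_X_power_dvd_q_pochhammer[of N] by (metis dvd_mult2)
  qed
  show ?thesis
  proof (rule fps_ext)
    fix m
    have "eventually (\<lambda>N. fps_nth (?t c N) m = fps_nth F m \<and> fps_nth (?t c' N) m = fps_nth F' m
        \<and> N > m) sequentially"
      using F F' unfolding sums_def tendsto_fps_iff
      by (intro eventually_conj eventually_gt_at_top) auto
    from eventually_happens'[OF sequentially_bot this]
    obtain N where N: "fps_nth (?t c N) m = fps_nth F m" "fps_nth (?t c' N) m = fps_nth F' m" "N > m"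
      by blast
    from fps_X_power_dvd_nth[OF dvd[of N] N(3)] show "fps_nth F m = fps_nth F' m"
      using N(1,2) by simp
  qed
qed

theorem habiro_at_exp_series:
  "(\<lambda>n. laurent_eval (fps_exp (1 :: rat)) (c n) * q_pochhammer (fps_exp 1) n) sums
     habiro_at_exp (habiro_series c)"
proof -
  let ?t = "\<lambda>c n. laurent_eval (fps_exp (1 :: rat)) (c n) * q_pochhammer (fps_exp 1) n"
  obtain F where F: "?t c sums F" using habiro_series_sums by blast
  have "habiro_at_exp (habiro_series c) = F"
    unfolding habiro_at_exp_def
  proof (rule the_equality)
    show "\<exists>c'. habiro_series c = habiro_series c' \<and> ?t c' sums F" using F by blast
  next
    fix F' assume "\<exists>c'. habiro_series c = habiro_series c' \<and> ?t c' sums F'"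
    then obtain c' where "habiro_series c = habiro_series c'" "?t c' sums F'" by blast
    then show "F' = F" using habiro_series_sums_unique[OF _ F] by simp
  qed
  with F show ?thesis by simp
qed

definition gevrey :: "complex fps \<Rightarrow> bool" where
  "gevrey F \<longleftrightarrow> (\<exists>C>(0::real). \<forall>n>0. norm (fps_nth F n) \<le> C ^ n * fact n)"

definition complex_fps_of_rat :: "rat fps \<Rightarrow> complex fps" where
  "complex_fps_of_rat F = Abs_fps (\<lambda>n. of_rat (fps_nth F n))"

end

theory Submission
  imports Defs
begin

text \<open>
  The proof compares coefficients with those of explicit majorants. Write \<open>h\<close> for \<open>1/x\<close>. Each factor
  \<open>1 - e\<^sup>i\<^sup>h\<close> with \<open>i \<le> n\<close> is majorised by \<open>i h e\<^sup>n\<^sup>h\<close>, so \<open>(e\<^sup>h)\<^sub>n\<close> is majorised by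
  \<open>n! h\<^sup>n exp (n\<^sup>2 h)\<close> (\<open>q_pochhammer_exp_majorised\<close>). A Laurent polynomial with \<open>1\<close>-norm at most \<open>C\<^sup>n\<close>
  and exponents in \<open>[-C' n\<^sup>2, C' n\<^sup>2]\<close> is majorised at \<open>q = e\<^sup>h\<close> by \<open>C\<^sup>n exp (C' n\<^sup>2 h)\<close>
  (\<open>laurent_eval_exp_majorised\<close>). Hence, with \<open>k = m - n\<close>, the \<open>n\<close>-th summand of \<open>f(e\<^sup>h)\<close>
  contributes to the coefficient of \<open>h\<^sup>m\<close> at most
  \<open>C\<^sup>n (C' + 1)\<^sup>k \<cdot> n! (n\<^sup>2)\<^sup>k / k!\<close>.

  The quadratic growth of the exponents is compatible with a Gevrey bound: one of the two
  factors \<open>n\<^sup>k\<close> is absorbed by \<open>n! n\<^sup>k \<le> (n + k)! = m!\<close>, and the other one by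
  \<open>n\<^sup>k / k! \<le> e\<^sup>n\<close> (\<open>fact_square_power_bound\<close>). Besides \<open>m!\<close>, only factors exponential in \<open>m\<close> remain.
  Since \<open>(e\<^sup>h)\<^sub>n\<close> is divisible by \<open>h\<^sup>n\<close>, only the \<open>m + 1 \<le> 2\<^sup>m\<close> summands with \<open>n \<le> m\<close> contribute.
  Nice boundedness says nothing about the summand \<open>n = 0\<close>; it is a single Laurent polynomial,
  whose expansion at \<open>q = e\<^sup>h\<close> even converges (\<open>laurent_eval_exp_nth_bound\<close>).
\<close>

definition majorised_by :: "rat fps \<Rightarrow> real fps \<Rightarrow> bool" (infix "\<lless>" 50) where
  "F \<lless> G \<longleftrightarrow> (\<forall>n. \<bar>real_of_rat (fps_nth F n)\<bar> \<le> fps_nth G n)"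

lemma majorised_by_nth: "F \<lless> G \<Longrightarrow> \<bar>real_of_rat (fps_nth F n)\<bar> \<le> fps_nth G n"
  by (simp add: majorised_by_def)

lemma majorised_by_mult:
  assumes "F \<lless> G" "F' \<lless> G'"
  shows "F * F' \<lless> G * G'"
  unfolding majorised_by_def
proof
  fix n
  have "\<bar>real_of_rat (fps_nth (F * F') n)\<bar> \<le>
      (\<Sum>i=0..n. \<bar>real_of_rat (fps_nth F i)\<bar> * \<bar>real_of_rat (fps_nth F' (n - i))\<bar>)"
    unfolding fps_mult_nth of_rat_sum of_rat_mult abs_mult[symmetric] by (rule sum_abs)
  also have "\<dots> \<le> (\<Sum>i=0..n. fps_nth G i * fps_nth G' (n - i))"
    by (intro sum_mono mult_mono' majorised_by_nth assms) auto
  finally show "\<bar>real_of_rat (fps_nth (F * F') n)\<bar> \<le> fps_nth (G * G') n"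
    by (simp add: fps_mult_nth)
qed

lemma majorised_by_prod:
  assumes "\<And>i. i \<in> A \<Longrightarrow> F i \<lless> G i"
  shows "(\<Prod>i\<in>A. F i) \<lless> (\<Prod>i\<in>A. G i)"
  using assms
proof (induction A rule: infinite_finite_induct)
  case (insert x A)
  then show ?case by (simp add: majorised_by_mult)
qed (auto simp: majorised_by_def)

lemma of_rat_fact: "of_rat (fact n) = (fact n :: 'a::field_char_0)"
  by (metis of_nat_fact of_rat_of_nat_eq)

lemma norm_of_rat_complex: "norm (of_rat r :: complex) = \<bar>real_of_rat r\<bar>"
  by (cases r) (simp add: of_rat_rat norm_divide)

text \<open>
  The coefficient of \<open>h\<^sup>m\<close> in \<open>e\<^sup>k\<^sup>h\<close> is \<open>k\<^sup>m / m!\<close>, whose absolute value is nondecreasing in \<open>\<bar>k\<bar>\<close>; so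
  every monomial is majorised by the exponential with the extreme exponent, weighted by the
  absolute value of its coefficient.
\<close>

lemma laurent_eval_exp_majorised:
  assumes "\<And>k. k \<in> Poly_Mapping.keys p \<Longrightarrow> \<bar>real_of_int k\<bar> \<le> R"
    and "real_of_int (laurent_norm1 p) \<le> N" and "0 \<le> R"
  shows "laurent_eval (fps_exp 1) p \<lless> fps_const N * fps_exp R"
  unfolding majorised_by_def
proof
  fix m
  have "real_of_rat (fps_nth (laurent_eval (fps_exp 1) p) m) =
      (\<Sum>k\<in>Poly_Mapping.keys p. real_of_int (Poly_Mapping.lookup p k) * (real_of_int k ^ m / fact m))"
    by (simp add: laurent_eval_def fps_exp_powi fps_sum_nth of_rat_sum of_rat_mult of_rat_divide
        of_rat_power of_rat_fact flip: fps_of_int)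
  then have "\<bar>real_of_rat (fps_nth (laurent_eval (fps_exp 1) p) m)\<bar> =
      \<bar>\<Sum>k\<in>Poly_Mapping.keys p. real_of_int (Poly_Mapping.lookup p k) * (real_of_int k ^ m / fact m)\<bar>"
    by (rule arg_cong)
  also have "\<dots> \<le> (\<Sum>k\<in>Poly_Mapping.keys p.
      \<bar>real_of_int (Poly_Mapping.lookup p k)\<bar> * (\<bar>real_of_int k\<bar> ^ m / fact m))"
    by (rule order_trans[OF sum_abs]) (simp add: abs_mult power_abs)
  also have "\<dots> \<le> (\<Sum>k\<in>Poly_Mapping.keys p.
      \<bar>real_of_int (Poly_Mapping.lookup p k)\<bar> * (R ^ m / fact m))"
    by (intro sum_mono mult_left_mono divide_right_mono power_mono assms(1)) auto
  also have "\<dots> = real_of_int (laurent_norm1 p) * (R ^ m / fact m)"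
    by (simp add: laurent_norm1_def sum_distrib_right sum_divide_distrib)
  also have "\<dots> \<le> N * (R ^ m / fact m)"
    using assms(2,3) by (intro mult_right_mono) auto
  finally show "\<bar>real_of_rat (fps_nth (laurent_eval (fps_exp 1) p) m)\<bar> \<le>
      fps_nth (fps_const N * fps_exp R) m" by simp
qed

text \<open>
  From \<open>i\<^sup>j\<^sup>+\<^sup>1 / (j + 1)! \<le> i \<cdot> i\<^sup>j / j!\<close>. The factor \<open>h\<close> keeps track of the order of vanishing;
  weakening \<open>e\<^sup>i\<^sup>h\<close> to \<open>e\<^sup>n\<^sup>h\<close> makes the product over \<open>i\<close> a plain power and costs only a constant
  factor in the exponent \<open>n\<^sup>2\<close>.
\<close>

lemma one_minus_exp_majorised:
  assumes "i \<le> n"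
  shows "1 - fps_exp 1 ^ i \<lless> fps_const (real i) * fps_X * fps_exp (real n)"
  unfolding majorised_by_def
proof
  fix m
  show "\<bar>real_of_rat (fps_nth (1 - fps_exp 1 ^ i) m)\<bar> \<le>
      fps_nth (fps_const (real i) * fps_X * fps_exp (real n)) m"
  proof (cases m)
    case (Suc j)
    have "\<bar>real_of_rat (fps_nth (1 - fps_exp 1 ^ i) m)\<bar> = real i ^ Suc j / fact (Suc j)"
      by (simp add: Suc fps_exp_power_mult of_rat_fact of_rat_divide of_rat_power of_rat_minus
          of_rat_mult del: fact_Suc power_Suc)
    also have "\<dots> \<le> real i * (real i ^ j / fact j)"
    proof -
      have "(fact j :: real) \<le> fact (Suc j)" by (rule fact_mono) simp
      then have "real i * real i ^ j / fact (Suc j) \<le> real i * real i ^ j / fact j"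
        by (intro divide_left_mono) auto
      then show ?thesis by simp
    qed
    also have "\<dots> \<le> real i * (real n ^ j / fact j)"
      using assms by (intro mult_left_mono divide_right_mono power_mono) auto
    finally show ?thesis by (simp add: Suc mult.assoc)
  qed (simp add: fps_exp_power_mult)
qed

lemma q_pochhammer_exp_majorised:
  "q_pochhammer (fps_exp 1) n \<lless> fps_const (fact n) * fps_X ^ n * fps_exp (real n ^ 2)"
proof -
  have "q_pochhammer (fps_exp 1) n \<lless>
      (\<Prod>i=1..n. fps_const (real i) * fps_X * fps_exp (real n))"
    unfolding q_pochhammer_def by (intro majorised_by_prod one_minus_exp_majorised) auto
  also have "(\<Prod>i=1..n. fps_const (real i) * fps_X * fps_exp (real n)) =
      (\<Prod>i=1..n. fps_const (real i)) * fps_X ^ n * fps_exp (real n) ^ n"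
    by (simp add: prod.distrib)
  also have "(\<Prod>i=1..n. fps_const (real i)) = fps_const (fact n)"
    by (induction n) (simp_all add: mult.commute)
  also have "fps_exp (real n) ^ n = fps_exp (real n ^ 2)"
    by (simp add: fps_exp_power_mult power2_eq_square)
  finally show ?thesis .
qed

lemma power_over_fact_le_exp:
  assumes "0 \<le> (x::real)"
  shows "x ^ k / fact k \<le> exp x"
proof -
  have "(\<Sum>i\<in>{k}. x ^ i /\<^sub>R fact i) \<le> suminf (\<lambda>i. x ^ i /\<^sub>R fact i)"
    using assms by (intro sum_le_suminf summable_exp_generic) auto
  then show ?thesis by (simp add: exp_def divide_inverse mult.commute)
qed

text \<open>Each of the \<open>k\<close> factors by which \<open>(n + k)!\<close> extends \<open>n!\<close> exceeds \<open>n\<close>.\<close>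

lemma fact_power_le_fact_add: "fact n * real n ^ k \<le> fact (n + k)"
proof (induction k)
  case (Suc k)
  have "fact n * real n ^ Suc k = fact n * real n ^ k * real n" by simp
  also have "\<dots> \<le> fact (n + k) * real (Suc (n + k))"
    by (intro mult_mono Suc) auto
  finally show ?case by (simp add: mult.commute)
qed simp

text \<open>
  This is where the quadratic bound on the exponents enters: of the two copies of \<open>n\<^sup>k\<close>, the
  factorial \<open>(n + k)!\<close> pays for one and \<open>1 / k!\<close> for the other.
\<close>

lemma fact_square_power_bound:
  "fact n * (real n ^ 2) ^ k / fact k \<le> exp 1 ^ n * fact (n + k)"
proof -
  have "fact n * (real n ^ 2) ^ k / fact k = (fact n * real n ^ k) * (real n ^ k / fact k)"
    by (simp add: power2_eq_square power_mult_distrib)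
  also have "\<dots> \<le> fact (n + k) * exp (real n)"
    by (intro mult_mono fact_power_le_fact_add power_over_fact_le_exp) auto
  also have "exp (real n) = exp 1 ^ n" by (simp flip: exp_of_nat_mult)
  finally show ?thesis by (simp add: mult.commute)
qed

text \<open>
  The sum stops at \<open>n = m\<close> because the \<open>n\<close>-th summand is divisible by the \<open>n\<close>-th power of the variable.
\<close>

lemma habiro_at_exp_nth:
  "fps_nth (habiro_at_exp (habiro_series c)) m =
     (\<Sum>n<Suc m. fps_nth (laurent_eval (fps_exp 1) (c n) * q_pochhammer (fps_exp 1) n) m)"
  using sums_unique2[OF habiro_at_exp_series[of c] habiro_series_sums[of c]]
  by (simp add: fps_sum_nth)

text \<open>
  The bases \<open>C + 1\<close> and \<open>C' + 1\<close> are at least \<open>1\<close>, so the exponents \<open>n\<close> and \<open>m - n\<close> can be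
  enlarged to \<open>m\<close>; the extra \<open>1\<close> in \<open>C' + 1\<close> is also needed for the exponential
  \<open>exp (n\<^sup>2 h)\<close> that comes from \<open>(e\<^sup>h)\<^sub>n\<close>.
\<close>

lemma summand_nth_bound:
  assumes keys: "\<And>k. k \<in> Poly_Mapping.keys p \<Longrightarrow> \<bar>real_of_int k\<bar> \<le> C' * real n ^ 2"
    and norm: "real_of_int (laurent_norm1 p) \<le> C ^ n"
    and nonneg: "0 \<le> C" "0 \<le> C'"
    and "n \<le> m"
  shows "\<bar>real_of_rat (fps_nth (laurent_eval (fps_exp 1) p * q_pochhammer (fps_exp 1) n) m)\<bar>
    \<le> ((C + 1) * (C' + 1) * exp 1) ^ m * fact m"
proof -
  obtain k where m: "m = n + k" using \<open>n \<le> m\<close> le_Suc_ex by blast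
  let ?G = "fps_const (C ^ n) * fps_exp (C' * real n ^ 2) *
    (fps_const (fact n) * fps_X ^ n * fps_exp (real n ^ 2))"
  have "\<bar>real_of_rat (fps_nth (laurent_eval (fps_exp 1) p * q_pochhammer (fps_exp 1) n) m)\<bar>
      \<le> fps_nth ?G m"
    using nonneg
    by (intro majorised_by_nth majorised_by_mult laurent_eval_exp_majorised keys norm
        q_pochhammer_exp_majorised) auto
  also have "?G = fps_X ^ n * (fps_const (C ^ n * fact n) * fps_exp ((C' + 1) * real n ^ 2))"
    by (simp only: distrib_right mult_1_left fps_exp_add_mult fps_const_mult[symmetric] mult_ac)
  also have "fps_nth \<dots> m = C ^ n * (C' + 1) ^ k * (fact n * (real n ^ 2) ^ k / fact k)"
    by (simp add: m fps_X_power_mult_nth power_mult_distrib)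
  also have "\<dots> \<le> C ^ n * (C' + 1) ^ k * (exp 1 ^ n * fact m)"
    using nonneg unfolding m by (intro mult_left_mono fact_square_power_bound) auto
  also have "\<dots> \<le> (C + 1) ^ m * (C' + 1) ^ m * (exp 1 ^ m * fact m)"
  proof (intro mult_mono)
    have "C ^ n \<le> (C + 1) ^ n" using nonneg by (intro power_mono) auto
    also have "\<dots> \<le> (C + 1) ^ m" using nonneg m by (intro power_increasing) auto
    finally show "C ^ n \<le> (C + 1) ^ m" .
  qed (use nonneg m in \<open>auto intro!: power_increasing\<close>)
  finally show ?thesis by (simp add: power_mult_distrib mult_ac)
qed

text \<open>
  For the summand \<open>n = 0\<close>. A multiplicative constant \<open>N\<close> is absorbed into the base of the power,
  which is possible because only positive \<open>m\<close> are considered.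
\<close>

lemma laurent_eval_exp_nth_bound:
  obtains B where "0 < B"
    and "\<And>m. 0 < m \<Longrightarrow> \<bar>real_of_rat (fps_nth (laurent_eval (fps_exp 1) p) m)\<bar> \<le> B ^ m * fact m"
proof -
  define N where "N = real_of_int (laurent_norm1 p)"
  define R where "R = (\<Sum>k\<in>Poly_Mapping.keys p. \<bar>real_of_int k\<bar>)"
  have nonneg: "0 \<le> N" "0 \<le> R"
    unfolding N_def R_def laurent_norm1_def by (auto intro!: sum_nonneg)
  have majorised: "laurent_eval (fps_exp 1) p \<lless> fps_const N * fps_exp R"
    using nonneg unfolding R_def
    by (intro laurent_eval_exp_majorised member_le_sum) (auto simp: N_def)
  show ?thesis
  proof
    show "0 < (N + 1) * (R + 1)" using nonneg by (intro mult_pos_pos) auto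
    fix m :: nat assume "0 < m"
    have "\<bar>real_of_rat (fps_nth (laurent_eval (fps_exp 1) p) m)\<bar> \<le> N * (R ^ m / fact m)"
      using majorised_by_nth[OF majorised, of m] by simp
    also have "\<dots> \<le> (N + 1) ^ m * ((R + 1) ^ m * fact m)"
    proof (rule mult_mono)
      have "N + 1 \<le> (N + 1) ^ m" using nonneg \<open>0 < m\<close> by (intro self_le_power) auto
      then show "N \<le> (N + 1) ^ m" by simp
      have "R ^ m / fact m \<le> R ^ m / 1"
        using nonneg by (intro divide_left_mono) auto
      also have "\<dots> \<le> (R + 1) ^ m * 1"
        using nonneg by (auto intro!: power_mono)
      also have "\<dots> \<le> (R + 1) ^ m * fact m"
        using nonneg by (intro mult_left_mono) auto
      finally show "R ^ m / fact m \<le> (R + 1) ^ m * fact m" .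
    qed (use nonneg in auto)
    finally show "\<bar>real_of_rat (fps_nth (laurent_eval (fps_exp 1) p) m)\<bar>
        \<le> ((N + 1) * (R + 1)) ^ m * fact m"
      by (simp add: power_mult_distrib mult.assoc)
  qed
qed

theorem theorem6:
  fixes f :: "nat \<Rightarrow> laurent set"
  assumes "f \<in> habiro_bounded"
  shows "gevrey (complex_fps_of_rat (habiro_at_exp f))"
proof -
  obtain c where c: "nicely_bounded c" and f: "f = habiro_series c"
    using assms by (auto simp: habiro_bounded_def)
  obtain C C' where C: "C > 0" "C' > 0"
    and keys: "\<And>n k. n > 0 \<Longrightarrow> k \<in> Poly_Mapping.keys (c n) \<Longrightarrow>
      real_of_int k \<in> {- C' * real n ^ 2 .. C' * real n ^ 2}"
    and norm: "\<And>n. n > 0 \<Longrightarrow> real_of_int (laurent_norm1 (c n)) \<le> C ^ n"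
    using c unfolding nicely_bounded_def by blast
  have abs_keys: "\<bar>real_of_int k\<bar> \<le> C' * real n ^ 2" if "n > 0" "k \<in> Poly_Mapping.keys (c n)" for n k
    using keys[OF that] by (simp add: abs_le_iff)
  let ?t = "\<lambda>n. laurent_eval (fps_exp 1) (c n) * q_pochhammer (fps_exp 1) n"
  obtain B where B: "0 < B" and
    B_bound: "\<And>m. 0 < m \<Longrightarrow>
      \<bar>real_of_rat (fps_nth (laurent_eval (fps_exp 1) (c 0)) m)\<bar> \<le> B ^ m * fact m"
    using laurent_eval_exp_nth_bound[of "c 0"] by blast
  define D where "D = max B ((C + 1) * (C' + 1) * exp 1)"
  have "0 < D" using B by (simp add: D_def)
  have summand_bound: "\<bar>real_of_rat (fps_nth (?t n) m)\<bar> \<le> D ^ m * fact m" if "n \<le> m" "0 < m" for n m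
  proof (cases "n = 0")
    case True
    have "\<bar>real_of_rat (fps_nth (?t n) m)\<bar> \<le> B ^ m * fact m"
      using B_bound[OF \<open>0 < m\<close>] by (simp add: True q_pochhammer_def)
    also have "\<dots> \<le> D ^ m * fact m"
      using B by (intro mult_right_mono power_mono) (auto simp: D_def)
    finally show ?thesis .
  next
    case False
    then have "\<bar>real_of_rat (fps_nth (?t n) m)\<bar> \<le> ((C + 1) * (C' + 1) * exp 1) ^ m * fact m"
      using C \<open>n \<le> m\<close> by (intro summand_nth_bound abs_keys norm) auto
    also have "\<dots> \<le> D ^ m * fact m"
      using C by (intro mult_right_mono power_mono) (auto simp: D_def)
    finally show ?thesis .
  qed
  have "norm (fps_nth (complex_fps_of_rat (habiro_at_exp f)) m) \<le> (2 * D) ^ m * fact m"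
    if "0 < m" for m
  proof -
    have "norm (fps_nth (complex_fps_of_rat (habiro_at_exp f)) m) =
        \<bar>real_of_rat (fps_nth (habiro_at_exp f) m)\<bar>"
      by (simp only: complex_fps_of_rat_def fps_nth_Abs_fps norm_of_rat_complex)
    also have "\<dots> \<le> (\<Sum>n<Suc m. \<bar>real_of_rat (fps_nth (?t n) m)\<bar>)"
      unfolding f habiro_at_exp_nth of_rat_sum by (rule sum_abs)
    also have "\<dots> \<le> (\<Sum>n<Suc m. D ^ m * fact m)"
      using that by (intro sum_mono summand_bound) auto
    also have "\<dots> = real (Suc m) * (D ^ m * fact m)" by simp
    also have "\<dots> \<le> 2 ^ m * (D ^ m * fact m)"
    proof (rule mult_right_mono)
      have "Suc m \<le> 2 ^ m" by (rule Suc_leI) (rule less_exp)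
      then have "real (Suc m) \<le> real (2 ^ m)" by (rule of_nat_mono)
      then show "real (Suc m) \<le> 2 ^ m" by simp
    qed (use \<open>0 < D\<close> in auto)
    finally show ?thesis by (simp add: power_mult_distrib mult.assoc)
  qed
  then show ?thesis
    unfolding gevrey_def using \<open>0 < D\<close> by (intro exI[of _ "2 * D"]) auto
qed

end
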